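(* Let $X \subset \mathbb{Z}^2$ be a finite fully convex set and let $z \in \mathrm{Vtcs}(\mathrm{CvxH}(X))$. Let $\mathcal{N}_X(z) = \{x \in X : |x_1 - z_1| \le 1 \text{ and } |x_2 - z_2| \le 1\}$. Then $z$ is peelable in $X$ if and only if $z$ is peelable in $\mathcal{N}_X(z)$.
   Context: Cells and full convexity. An open cell of the cubical complex of $\mathbb{R}^d$ induced by $\mathbb{Z}^d$ is a product $c = c_1 \times \cdots \times c_d$ where each $c_j$ is either a singleton $\{a\}$ or an open interval $(a,a+1)$ with $a \in \mathbb{Z}$; it is a $k$-cell if exactly $k$ of the factors are open intervals. For $Y \subset \mathbb{R}^d$ and $0 \le k \le d$, let $\bar{\mathcal{C}}^d_k[Y]$ be the set of $k$-cells whose topological closure in $\mathbb{R}^d$ meets $Y$. Let $\mathrm{CvxH}(Y)$ be the convex hull of $Y$ in $\mathbb{R}^d$. A set $X \subset \mathbb{Z}^d$ is fully convex if $\bar{\mathcal{C}}^d_k[X] = \bar{\mathcal{C}}^d_k[\mathrm{CvxH}(X)]$ for all $k$ with $0 \le k \le d$. Vertices and projections. $\mathrm{Vtcs}(P)$ denotes the set of extreme points (vertices) of a polytope $P$. Let $I_d=\{1,\ldots,d\}$, let $\mathbf{e}_i$ be the $i$-th canonical basis vector, and for $i \in I_d$ let $\pi_i : \mathbb{R}^d \to \mathbb{R}^{d-1}$ be the map that omits the $i$-th coordinate. It is known that if $d\ge 2$ and $X$ is fully convex in $\mathbb{Z}^d$ then $\pi_i(X)$ is fully convex in $\mathbb{Z}^{d-1}$.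 Peelability (defined by recursion on $d$). For a fully convex set $X \subset \mathbb{Z}^d$ and $z \in X$, $z$ is peelable in $X$ when $z \in \mathrm{Vtcs}(\mathrm{CvxH}(X))$ and, when $d \geq 2$, for every $i \in I_d$, either (i) $z - \mathbf{e}_i \in X$ or $z + \mathbf{e}_i \in X$, or (ii) $\pi_i(z)$ is peelable in $\pi_i(X) \subset \mathbb{Z}^{d-1}$. (So when $d=1$, $z$ is peelable iff it is a vertex of $\mathrm{CvxH}(X)$.) The set $\mathcal{N}_X(z)$ (the $3\times 3$ neighborhood of $z$ in $X$) is again fully convex, being the intersection of a fully convex set with an axis-aligned box with integer bounds, so peelability in it is well defined. *)

theory Defs
  imports "HOL-Analysis.Analysis" "HOL-Analysis.Finite_Function_Topology"
begin

text \<open>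
  The dimension must be a term, since peelability is defined by recursion on it.  Points are
  therefore finitely supported sequences, a type that HOL-Analysis equips with the structure of
  a real normed vector space, and \<open>\<real>\<^sup>d\<close> is the subspace of points supported on
  \<open>{0, \<dots>, d - 1}\<close> (indices start at \<open>0\<close>).  This subspace is closed and carries the
  usual topology, so the closures and convex hulls of its subsets, taken in the whole type, are
  those taken in \<open>\<real>\<^sup>d\<close>.
\<close>

type_synonym point = "nat \<Rightarrow>\<^sub>0 real"

abbreviation coord :: "point \<Rightarrow> nat \<Rightarrow> real"
  where "coord \<equiv> Poly_Mapping.lookup"

definition real_space :: "nat \<Rightarrow> point set"
  where "real_space d = {x. \<forall>j\<ge>d. coord x j = 0}"

definition int_lattice :: "nat \<Rightarrow> point set"
  where "int_lattice d = {x \<in> real_space d. \<forall>j<d. coord x j \<in> \<int>}"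

text \<open>
  The open cell with lower corner \<open>a\<close> whose factors are open unit intervals exactly in the
  directions of \<open>J\<close>.
\<close>

definition open_cell :: "nat \<Rightarrow> nat set \<Rightarrow> (nat \<Rightarrow> int) \<Rightarrow> point set"
  where "open_cell d J a =
    {x \<in> real_space d. \<forall>j<d.
       coord x j \<in> (if j \<in> J then {of_int (a j)<..<of_int (a j) + 1} else {of_int (a j)})}"

definition cells :: "nat \<Rightarrow> nat \<Rightarrow> point set set"
  where "cells d k = {open_cell d J a | J a. J \<subseteq> {..<d} \<and> card J = k}"

definition touching_cells :: "nat \<Rightarrow> nat \<Rightarrow> point set \<Rightarrow> point set set"
  where "touching_cells d k Y = {c \<in> cells d k. closure c \<inter> Y \<noteq> {}}"

definition fully_convex :: "nat \<Rightarrow> point set \<Rightarrow> bool"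
  where "fully_convex d X \<longleftrightarrow> X \<subseteq> int_lattice d \<and>
    (\<forall>k\<le>d. touching_cells d k X = touching_cells d k (convex hull X))"

definition vertices :: "point set \<Rightarrow> point set"
  where "vertices P = {z. z extreme_point_of P}"

definition basis_vec :: "nat \<Rightarrow> point"
  where "basis_vec i = Poly_Mapping.single i 1"

definition omit_coord :: "nat \<Rightarrow> point \<Rightarrow> point"
  where "omit_coord i = Poly_Mapping.map_key (\<lambda>j. if j < i then j else Suc j)"

lemma coord_omit_coord: "coord (omit_coord i x) j = coord x (if j < i then j else Suc j)"
proof -
  have "inj (\<lambda>j. if j < i then j else Suc j)"
    by (auto simp: inj_on_def split: if_splits)
  then show ?thesis
    by (simp add: omit_coord_def map_key.rep_eq)
qed

text \<open>Only meaningful for \<open>d \<ge> 1\<close> and \<open>X\<close> fully convex in \<open>\<int>\<^sup>d\<close>.\<close>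

fun peelable :: "nat \<Rightarrow> point set \<Rightarrow> point \<Rightarrow> bool"
  where "peelable d X z \<longleftrightarrow>
    z \<in> X \<and> z \<in> vertices (convex hull X) \<and>
    (2 \<le> d \<longrightarrow> (\<forall>i<d.
       (z - basis_vec i \<in> X \<or> z + basis_vec i \<in> X) \<or>
       peelable (d - 1) (omit_coord i ` X) (omit_coord i z)))"

declare peelable.simps [simp del]

definition nbhd3x3 :: "point set \<Rightarrow> point \<Rightarrow> point set"
  where "nbhd3x3 X z =
    {x \<in> X. \<bar>coord x 0 - coord z 0\<bar> \<le> 1 \<and> \<bar>coord x 1 - coord z 1\<bar> \<le> 1}"

end

theory Submission
  imports Defs
begin

text \<open>
  The point \<open>z\<close> is not an end of the projection \<open>\<pi>\<^sub>i X\<close> on a given side iff some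
  \<open>x \<in> X\<close> lies strictly on that side of \<open>z\<close> in the other coordinate \<open>j\<close>.  Follow the segment from
  \<open>z\<close> to \<open>x\<close> up to the point \<open>p\<close> at maximum-norm distance \<open>1\<close> from \<open>z\<close>.  Full convexity,
  applied to the cell containing \<open>p\<close>, gives a point of \<open>X\<close> on the closure of this cell, hence
  in the neighborhood of \<open>z\<close>.  If neither \<open>z - e\<^sub>i\<close> nor \<open>z + e\<^sub>i\<close> is in \<open>X\<close>, this point still lies
  strictly on the given side, so the projection of the neighborhood has the same ends at \<open>z\<close>.
\<close>

section \<open>Coordinates as bounded linear functionals\<close>

lemma coord_scaleR [simp]: "coord (r *\<^sub>R x) j = r * coord x j"
proof -
  have "finite {i. r * coord x i \<noteq> 0}"
    by (rule finite_subset [OF _ finite_lookup [of x]]) auto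
  then show ?thesis
    by (simp add: scaleR_poly_mapping_def Abs_poly_mapping_inverse)
qed

lemma bounded_linear_coord: "bounded_linear (\<lambda>x. coord x j)"
proof (rule bounded_linear_intro)
  fix x :: point
  show "norm (coord x j) \<le> norm x * 1"
  proof (cases "j \<in> Poly_Mapping.keys x")
    case True
    then have "\<bar>coord x j\<bar> \<le> (\<Sum>n\<in>Poly_Mapping.keys x. \<bar>coord x n\<bar>)"
      by (intro member_le_sum) auto
    then show ?thesis
      by (simp add: norm_poly_mapping_def dist_poly_mapping_def)
  qed (simp add: in_keys_iff)
qed (simp_all add: lookup_add)

lemmas continuous_on_coord [continuous_intros] =
  bounded_linear.continuous_on [OF bounded_linear_coord]

lemma linear_coord: "linear (\<lambda>x. coord x j)"
  by (rule bounded_linear.linear [OF bounded_linear_coord])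

section \<open>Full convexity as a rounding property\<close>

lemma convex_hull_real_space:
  assumes "X \<subseteq> real_space d"
  shows "convex hull X \<subseteq> real_space d"
  using assms
  by (rule hull_minimal) (auto simp: convex_def real_space_def lookup_add)

lemma closure_open_cell_coord:
  assumes "x \<in> closure (open_cell d J a)" "j < d"
  shows "of_int (a j) \<le> coord x j"
    and "coord x j \<le> (if j \<in> J then of_int (a j) + 1 else of_int (a j))"
proof -
  let ?C = "{x. of_int (a j) \<le> coord x j \<and>
    coord x j \<le> (if j \<in> J then of_int (a j) + 1 else of_int (a j))}"
  have "closed ?C"
    by (intro closed_Collect_conj closed_Collect_le continuous_intros)
  moreover have "open_cell d J a \<subseteq> ?C"
    using \<open>j < d\<close> by (auto simp: open_cell_def split: if_splits)
  ultimately have "x \<in> ?C"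
    using assms(1) closure_minimal by blast
  then show "of_int (a j) \<le> coord x j"
    and "coord x j \<le> (if j \<in> J then of_int (a j) + 1 else of_int (a j))"
    by auto
qed

text \<open>The open cell containing \<open>p\<close> touches the hull, so by full convexity its
  closure meets \<open>X\<close>. The bounds describe this closed cell: \<open>x\<close> keeps the
  integer coordinates of \<open>p\<close>, and its other coordinates stay between the two
  neighboring integers.\<close>

lemma fully_convex_round:
  assumes "fully_convex d X" "p \<in> convex hull X"
  obtains x where "x \<in> X"
    "\<And>j. j < d \<Longrightarrow> of_int \<lfloor>coord p j\<rfloor> \<le> coord x j \<and> coord x j \<le> of_int \<lceil>coord p j\<rceil>"
proof -
  define J where "J = {j. j < d \<and> coord p j \<notin> \<int>}"
  define c where "c = open_cell d J (\<lambda>j. \<lfloor>coord p j\<rfloor>)"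
  have J: "J \<subseteq> {..<d}"
    by (auto simp: J_def)
  then have card: "card J \<le> d"
    using card_mono [OF finite_lessThan J] by simp
  have "p \<in> real_space d"
    using assms convex_hull_real_space [of X d] by (auto simp: fully_convex_def int_lattice_def)
  moreover have "of_int \<lfloor>t\<rfloor> < t \<and> t < of_int \<lfloor>t\<rfloor> + 1" if "t \<notin> \<int>" for t :: real
  proof -
    have "t \<noteq> of_int \<lfloor>t\<rfloor>"
      using that by (metis Ints_of_int)
    then show ?thesis
      by linarith
  qed
  ultimately have "p \<in> c"
    by (auto simp: c_def open_cell_def J_def elim!: Ints_cases)
  then have "c \<in> touching_cells d (card J) (convex hull X)"
    using assms(2) J closure_subset [of c]
    unfolding touching_cells_def cells_def c_def by blast
  then have "c \<in> touching_cells d (card J) X"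
    using assms(1) card by (auto simp: fully_convex_def)
  then obtain x where x: "x \<in> X" "x \<in> closure c"
    by (auto simp: touching_cells_def)
  have "of_int \<lfloor>coord p j\<rfloor> \<le> coord x j \<and> coord x j \<le> of_int \<lceil>coord p j\<rceil>" if "j < d" for j
  proof -
    \<comment> \<open>Floor and ceiling differ exactly in the open directions \<open>J\<close>, so
      the ceiling is the upper end of the closed factor in both cases.\<close>
    have "\<lceil>coord p j\<rceil> = \<lfloor>coord p j\<rfloor> + 1" if "j \<in> J"
      using that by (auto simp: J_def ceiling_altdef Ints_def)
    moreover have "\<lceil>coord p j\<rceil> = \<lfloor>coord p j\<rfloor>" if "j \<notin> J"
      using that \<open>j < d\<close> by (auto simp: J_def elim!: Ints_cases)
    ultimately show ?thesis
      using closure_open_cell_coord [OF x(2) [unfolded c_def] \<open>j < d\<close>]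
      by (cases "j \<in> J") auto
  qed
  then show thesis
    using that x(1) by blast
qed

section \<open>Peelability in dimension 1\<close>

lemma peelable_1_iff:
  assumes "S \<subseteq> real_space 1"
  shows "peelable 1 S w \<longleftrightarrow> w \<in> S \<and>
    ((\<forall>y\<in>S. coord y 0 \<le> coord w 0) \<or> (\<forall>y\<in>S. coord w 0 \<le> coord y 0))"
proof -
  have H: "convex hull S \<subseteq> real_space 1"
    using assms by (rule convex_hull_real_space)
  have eqI: "x = y" if "x \<in> real_space 1" "y \<in> real_space 1" "coord x 0 = coord y 0" for x y
  proof (rule poly_mapping_eqI)
    show "coord x j = coord y j" for j
      using that by (cases j) (auto simp: real_space_def)
  qed
  have seg: "w \<in> open_segment x y"
    if "w \<in> real_space 1" "x \<in> real_space 1" "y \<in> real_space 1"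
      "coord x 0 < coord w 0" "coord w 0 < coord y 0" for x y
  proof -
    \<comment> \<open>The parameter at which the segment from \<open>x\<close> to \<open>y\<close>
      reaches coordinate \<open>0\<close> of \<open>w\<close>; on a line this determines the
      point.\<close>
    define u where "u = (coord w 0 - coord x 0) / (coord y 0 - coord x 0)"
    have "w = (1 - u) *\<^sub>R x + u *\<^sub>R y"
    proof (rule eqI)
      show "(1 - u) *\<^sub>R x + u *\<^sub>R y \<in> real_space 1"
        using that by (auto simp: real_space_def lookup_add)
      have "u * (coord y 0 - coord x 0) = coord w 0 - coord x 0"
        using that by (simp add: u_def)
      then show "coord w 0 = coord ((1 - u) *\<^sub>R x + u *\<^sub>R y) 0"
        by (simp add: lookup_add lookup_minus algebra_simps)
    qed fact
    moreover have "0 < u" "u < 1"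
      using that by (simp_all add: u_def field_simps)
    ultimately show ?thesis
      using that by (auto simp: in_segment)
  qed
  \<comment> \<open>The factor \<open>s\<close> handles a maximum (\<open>s = 1\<close>) and a
    minimum (\<open>s = -1\<close>) together.\<close>
  have ends: "w extreme_point_of convex hull S"
    if "w \<in> S" and s: "s \<noteq> 0" and le: "\<And>y. y \<in> S \<Longrightarrow> s * coord y 0 \<le> s * coord w 0" for s :: real
  proof -
    have "convex {y. s * coord y 0 \<le> s * coord w 0}"
      using convex_linear_vimage [OF linear_coord convex_halfspace_le [of s "s * coord w 0"], of 0]
      by (simp add: vimage_def)
    then have hull: "s * coord y 0 \<le> s * coord w 0" if "y \<in> convex hull S" for y
      using hull_minimal [of S "{y. s * coord y 0 \<le> s * coord w 0}" convex] le that by blast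
    have False if xy: "x \<in> convex hull S" "y \<in> convex hull S" "w \<in> open_segment x y" for x y
    proof -
      obtain u where u: "x \<noteq> y" "0 < u" "u < 1" and w: "w = (1 - u) *\<^sub>R x + u *\<^sub>R y"
        using xy(3) by (auto simp: in_segment)
      \<comment> \<open>Both gaps are nonnegative, and their average with the positive weights
        \<open>1 - u\<close> and \<open>u\<close> is zero because \<open>w\<close> is that average
        of \<open>x\<close> and \<open>y\<close>. Hence both vanish and the segment
        degenerates.\<close>
      define a b where "a = s * (coord w 0 - coord x 0)" and "b = s * (coord w 0 - coord y 0)"
      have "a \<ge> 0" "b \<ge> 0"
        using hull [OF xy(1)] hull [OF xy(2)] by (auto simp: a_def b_def algebra_simps)
      moreover have "(1 - u) * a + u * b = 0"
        unfolding a_def b_def w by (simp add: lookup_add lookup_minus algebra_simps)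
      ultimately have "a = 0" "b = 0"
        using u by (simp_all add: add_nonneg_eq_0_iff)
      then have "coord x 0 = coord y 0"
        using s by (simp add: a_def b_def)
      then have "x = y"
        using eqI H xy by blast
      then show False
        using u by simp
    qed
    then show ?thesis
      using \<open>w \<in> S\<close> hull_inc by (fastforce simp: extreme_point_of_def)
  qed
  have "w extreme_point_of convex hull S \<longleftrightarrow>
      (\<forall>y\<in>S. coord y 0 \<le> coord w 0) \<or> (\<forall>y\<in>S. coord w 0 \<le> coord y 0)" if "w \<in> S"
  proof
    assume ext: "w extreme_point_of convex hull S"
    show "(\<forall>y\<in>S. coord y 0 \<le> coord w 0) \<or> (\<forall>y\<in>S. coord w 0 \<le> coord y 0)"
    proof (rule ccontr)
      assume "\<not> ?thesis"
      then obtain x y where "x \<in> S" "y \<in> S" "coord x 0 < coord w 0" "coord w 0 < coord y 0"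
        by (meson not_le)
      then have "w \<in> open_segment x y" "x \<in> convex hull S" "y \<in> convex hull S"
        using seg assms \<open>w \<in> S\<close> by (auto simp: hull_inc)
      then show False
        using ext by (auto simp: extreme_point_of_def)
    qed
  next
    assume "(\<forall>y\<in>S. coord y 0 \<le> coord w 0) \<or> (\<forall>y\<in>S. coord w 0 \<le> coord y 0)"
    then show "w extreme_point_of convex hull S"
      using ends [OF that, of 1] ends [OF that, of "-1"] by auto
  qed
  then show ?thesis
    by (subst peelable.simps) (auto simp: vertices_def)
qed

text \<open>For \<open>i < 2\<close> the coordinate that survives the projection is
  \<open>1 - i\<close>, and it becomes coordinate \<open>0\<close> of the image.\<close>

lemma peelable_omit_coord_iff:
  assumes "X \<subseteq> real_space 2" "z \<in> X" "i < 2"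
  shows "peelable 1 (omit_coord i ` X) (omit_coord i z) \<longleftrightarrow>
    (\<forall>y\<in>X. coord y (1 - i) \<le> coord z (1 - i)) \<or> (\<forall>y\<in>X. coord z (1 - i) \<le> coord y (1 - i))"
proof -
  have "omit_coord i ` X \<subseteq> real_space 1"
    using assms by (auto simp: real_space_def coord_omit_coord)
  moreover have "coord (omit_coord i y) 0 = coord y (1 - i)" for y
    using \<open>i < 2\<close> by (auto simp: coord_omit_coord less_2_cases_iff)
  ultimately show ?thesis
    using assms(2) by (simp only: peelable_1_iff) auto
qed

section \<open>Replacing a point of \<open>X\<close> by one in the neighborhood\<close>

text \<open>Using \<open>sgn\<close> covers both sides at once. Rounding could lose the side only by
  giving \<open>y\<close> the same coordinate \<open>1 - i\<close> as \<open>z\<close>; then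
  \<open>y\<close> would be one of the two excluded neighbors.\<close>

lemma nbhd3x3_side:
  assumes fc: "fully_convex 2 X" and X: "z \<in> X" "x \<in> X" and "i < 2"
    and off: "z - basis_vec i \<notin> X" "z + basis_vec i \<notin> X"
    and ne: "coord x (1 - i) \<noteq> coord z (1 - i)"
  obtains y where "y \<in> nbhd3x3 X z"
    "coord y (1 - i) = coord z (1 - i) + sgn (coord x (1 - i) - coord z (1 - i))"
proof -
  define j where "j = 1 - i"
  have ij: "i < 2" "j < 2" "i \<noteq> j" and cover: "\<And>k. k < 2 \<longleftrightarrow> k = i \<or> k = j"
    using \<open>i < 2\<close> by (auto simp: j_def less_2_cases_iff)
  have lat: "X \<subseteq> int_lattice 2"
    using fc by (simp add: fully_convex_def)
  have int: "coord v k \<in> \<int>" if "v \<in> X" "k < 2" for v k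
    using that lat by (auto simp: int_lattice_def)
  define a b where "a = coord x i - coord z i" and "b = coord x j - coord z j"
  have ab: "a \<in> \<int>" "b \<in> \<int>" "b \<noteq> 0"
    using int X ij ne by (auto simp: a_def b_def j_def)
  \<comment> \<open>The maximum-norm distance from \<open>z\<close> to \<open>x\<close>. It is at
    least 1 since \<open>b\<close> is a nonzero integer, so the weight \<open>1 / m\<close> below is
    at most 1.\<close>
  define m where "m = max \<bar>a\<bar> \<bar>b\<bar>"
  have m: "m \<ge> 1" "\<bar>a\<bar> \<le> m" "\<bar>b\<bar> \<le> m"
    using Ints_nonzero_abs_ge1 [OF ab(2,3)] by (auto simp: m_def)
  define p where "p = (1 - 1 / m) *\<^sub>R z + (1 / m) *\<^sub>R x"
  have "p \<in> convex hull X"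
    unfolding p_def using m X
    by (intro convexD [OF convex_convex_hull]) (auto simp: hull_inc)
  then obtain y where y: "y \<in> X" and
    round: "\<And>k. k < 2 \<Longrightarrow> of_int \<lfloor>coord p k\<rfloor> \<le> coord y k \<and> coord y k \<le> of_int \<lceil>coord p k\<rceil>"
    using fully_convex_round [OF fc] by metis
  have p: "coord p i = coord z i + a / m" "coord p j = coord z j + b / m"
    using m by (simp_all add: p_def a_def b_def lookup_add field_simps)
  \<comment> \<open>As \<open>z\<close> is integral, rounding \<open>p\<close> amounts to rounding
    the offsets \<open>a / m\<close> and \<open>b / m\<close>; \<open>u\<close> and \<open>v\<close>
    are the rounded values.\<close>
  obtain s t where st: "coord z i = of_int s" "coord z j = of_int t"
    using int X ij by (meson Ints_cases)
  have ceiling: "\<lceil>of_int k + r\<rceil> = k + \<lceil>r\<rceil>" for k and r :: real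
    by (metis add.commute ceiling_add_of_int)
  define u v where "u = coord y i - coord z i" and "v = coord y j - coord z j"
  have u: "of_int \<lfloor>a / m\<rfloor> \<le> u" "u \<le> of_int \<lceil>a / m\<rceil>"
    using round [OF ij(1)] by (auto simp: p st u_def ceiling)
  have v: "of_int \<lfloor>b / m\<rfloor> \<le> v" "v \<le> of_int \<lceil>b / m\<rceil>"
    using round [OF ij(2)] by (auto simp: p st v_def ceiling)
  have unit: "-1 \<le> r / m" "r / m \<le> 1" if "\<bar>r\<bar> \<le> m" for r
    using that m by (auto simp: field_simps)
  have bound: "\<bar>w\<bar> \<le> 1" if "\<bar>r\<bar> \<le> m" "of_int \<lfloor>r / m\<rfloor> \<le> w" "w \<le> of_int \<lceil>r / m\<rceil>" for r w :: real
  proof -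
    have "-1 \<le> \<lfloor>r / m\<rfloor>" "\<lceil>r / m\<rceil> \<le> 1"
      using unit [OF that(1)] by (auto simp: le_floor_iff ceiling_le_iff)
    then show ?thesis
      using that(2,3) by linarith
  qed
  \<comment> \<open>In a direction attaining the maximum the offset is already 1 or -1, which leaves
    no freedom in rounding.\<close>
  have one: "w = sgn r" if "\<bar>r\<bar> = m" "of_int \<lfloor>r / m\<rfloor> \<le> w" "w \<le> of_int \<lceil>r / m\<rceil>" for r w :: real
  proof -
    have "r / m = of_int (if r > 0 then 1 else - 1)"
      using that(1) m by (auto simp: abs_if split: if_splits)
    then have "w = of_int (if r > 0 then 1 else - 1)"
      using that(2,3) by (metis antisym ceiling_of_int floor_of_int)
    then show ?thesis
      using that(1) m by (auto simp: sgn_if)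
  qed
  have nbhd: "y \<in> nbhd3x3 X z"
  proof -
    have "\<bar>u\<bar> \<le> 1" "\<bar>v\<bar> \<le> 1"
      using bound u v m by blast+
    then have "\<bar>coord y k - coord z k\<bar> \<le> 1" if "k < 2" for k
      using that cover [of k] by (auto simp: u_def v_def)
    then show ?thesis
      using y by (simp add: nbhd3x3_def)
  qed
  have "v = sgn b"
  proof (cases "\<bar>b\<bar> = m")
    case True
    then show ?thesis
      using one v by blast
  next
    case False
    then have am: "\<bar>a\<bar> = m" "\<bar>b\<bar> < m"
      using m by (auto simp: m_def max_def split: if_splits)
    \<comment> \<open>Direction \<open>i\<close> attains the maximum here, so \<open>u\<close> is 1
      or -1, and \<open>v = 0\<close> would put \<open>z + basis_vec i\<close> or
      \<open>z - basis_vec i\<close> into \<open>X\<close>.\<close>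
    have "v \<noteq> 0"
    proof
      assume "v = 0"
      have "\<bar>u\<bar> = 1"
        using one [OF am(1) u] am m by (auto simp: sgn_if)
      have "y = z + u *\<^sub>R basis_vec i"
      proof (rule poly_mapping_eqI)
        fix k
        show "coord y k = coord (z + u *\<^sub>R basis_vec i) k"
          using \<open>v = 0\<close> cover [of k] ij subsetD [OF lat y] subsetD [OF lat X(1)]
          by (cases "k < 2")
            (auto simp: u_def v_def basis_vec_def lookup_add lookup_single when_def
              int_lattice_def real_space_def not_less)
      qed
      then show False
        using off y \<open>\<bar>u\<bar> = 1\<close> by (auto simp: abs_if split: if_splits)
    qed
    have "v \<in> \<int>"
      using int y X ij by (auto simp: v_def)
    then have "\<bar>v\<bar> \<ge> 1"
      using \<open>v \<noteq> 0\<close> by (rule Ints_nonzero_abs_ge1)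
    have "\<bar>v\<bar> \<le> 1"
      using bound v m by blast
    \<comment> \<open>Rounding \<open>b / m\<close> cannot cross the integer 0, so \<open>v\<close>,
      of absolute value 1, inherits the sign of \<open>b\<close>.\<close>
    consider "b > 0" | "b < 0"
      using ab by linarith
    then show ?thesis
    proof cases
      case 1
      then have "(0::real) \<le> of_int \<lfloor>b / m\<rfloor>"
        using m by simp
      then have "0 \<le> v"
        using v(1) by linarith
      then show ?thesis
        using 1 \<open>\<bar>v\<bar> \<ge> 1\<close> \<open>\<bar>v\<bar> \<le> 1\<close> by (simp add: sgn_if)
    next
      case 2
      then have "of_int \<lceil>b / m\<rceil> \<le> (0::real)"
        using m by (simp add: divide_nonpos_pos)
      then have "v \<le> 0"
        using v(2) by linarith
      then show ?thesis
        using 2 \<open>\<bar>v\<bar> \<ge> 1\<close> \<open>\<bar>v\<bar> \<le> 1\<close> by (simp add: sgn_if)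
    qed
  qed
  then show thesis
    using that nbhd by (simp add: v_def b_def j_def)
qed

theorem lemma5:
  fixes X :: "point set" and z :: point
  assumes "finite X"
    and "fully_convex 2 X"
    and "z \<in> vertices (convex hull X)"
  shows "peelable 2 X z \<longleftrightarrow> peelable 2 (nbhd3x3 X z) z"
proof -
  let ?N = "nbhd3x3 X z"
  have NX: "?N \<subseteq> X"
    by (auto simp: nbhd3x3_def)
  have space: "X \<subseteq> real_space 2"
    using assms(2) by (auto simp: fully_convex_def int_lattice_def)
  have zX: "z \<in> X"
    using assms(3) extreme_point_of_convex_hull by (auto simp: vertices_def)
  then have zN: "z \<in> ?N"
    by (simp add: nbhd3x3_def)
  \<comment> \<open>An extreme point of a set remains extreme in every subset containing it.\<close>
  have vertex: "z \<in> vertices (convex hull ?N)"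
    using assms(3) hull_mono [OF NX, of convex] zN hull_inc [of z ?N convex]
    by (auto simp: vertices_def extreme_point_of_def)
  have neighbours: "z - basis_vec i \<in> ?N \<longleftrightarrow> z - basis_vec i \<in> X"
    "z + basis_vec i \<in> ?N \<longleftrightarrow> z + basis_vec i \<in> X" for i
    by (auto simp: nbhd3x3_def basis_vec_def lookup_add lookup_minus lookup_single when_def)
  \<comment> \<open>The projections need comparing only for those \<open>i\<close> where the first
    alternative of peelability fails; by \<open>neighbours\<close>, it fails for \<open>X\<close>
    and \<open>?N\<close> simultaneously.\<close>
  have proj: "peelable 1 (omit_coord i ` X) (omit_coord i z) \<longleftrightarrow>
      peelable 1 (omit_coord i ` ?N) (omit_coord i z)"
    if "i < 2" and off: "z - basis_vec i \<notin> X" "z + basis_vec i \<notin> X" for i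
  proof -
    let ?j = "1 - i"
    have side: "\<exists>y\<in>?N. coord y ?j = coord z ?j + sgn (coord x ?j - coord z ?j)"
      if "x \<in> X" "coord x ?j \<noteq> coord z ?j" for x
      using nbhd3x3_side [OF assms(2) zX that(1) \<open>i < 2\<close> off that(2)] by blast
    have "(\<forall>y\<in>X. coord y ?j \<le> coord z ?j) \<longleftrightarrow> (\<forall>y\<in>?N. coord y ?j \<le> coord z ?j)"
    proof (intro iffI ballI)
      fix x
      assume N: "\<forall>y\<in>?N. coord y ?j \<le> coord z ?j" and "x \<in> X"
      show "coord x ?j \<le> coord z ?j"
      proof (rule ccontr)
        assume "\<not> ?thesis"
        then obtain y where "y \<in> ?N" "coord y ?j = coord z ?j + 1"
          using side [OF \<open>x \<in> X\<close>] by auto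
        then show False
          using N by fastforce
      qed
    qed (use NX in auto)
    moreover have "(\<forall>y\<in>X. coord z ?j \<le> coord y ?j) \<longleftrightarrow> (\<forall>y\<in>?N. coord z ?j \<le> coord y ?j)"
    proof (intro iffI ballI)
      fix x
      assume N: "\<forall>y\<in>?N. coord z ?j \<le> coord y ?j" and "x \<in> X"
      show "coord z ?j \<le> coord x ?j"
      proof (rule ccontr)
        assume "\<not> ?thesis"
        then obtain y where "y \<in> ?N" "coord y ?j = coord z ?j - 1"
          using side [OF \<open>x \<in> X\<close>] by auto
        then show False
          using N by fastforce
      qed
    qed (use NX in auto)
    ultimately show ?thesis
      using peelable_omit_coord_iff [OF space zX \<open>i < 2\<close>]
        peelable_omit_coord_iff [OF subset_trans [OF NX space] zN \<open>i < 2\<close>] by blast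
  qed
  \<comment> \<open>The recursion is unfolded once only, keeping the projections in the form that
    \<open>proj\<close> compares.\<close>
  have unfold: "peelable 2 Y z \<longleftrightarrow> z \<in> Y \<and> z \<in> vertices (convex hull Y) \<and>
      (\<forall>i<2. (z - basis_vec i \<in> Y \<or> z + basis_vec i \<in> Y) \<or>
        peelable 1 (omit_coord i ` Y) (omit_coord i z))" for Y
    by (subst peelable.simps) simp
  show ?thesis
    unfolding unfold neighbours using zX zN assms(3) vertex proj by blast
qed

end
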